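(* Let $n\ge1$ and let $\mathbb{F}$ be a field with $\mathrm{char}(\mathbb{F})>n$. Suppose that $\beta\in\mathbb{F}\setminus\{0,\ldots,n\}$. Then the system $\sum_{i=1}^n x_iy_i-\beta$, $\{x_i^2-x_i\}_{i=1}^n$, $\{y_i^2-y_i\}_{i=1}^n$ is unsatisfiable, and any roABP-$\mathrm{IPS}_{\mathrm{LIN}}$ refutation of it, where the roABP reads (all of) $\overline{x}$ before $\overline{y}$, requires width $\ge\exp(\Omega(n))$. In particular, any $\sum\bigwedge\sum$-$\mathrm{IPS}_{\mathrm{LIN}}$ refutation of it requires size $\ge\exp(\Omega(n))$.
   Context: Here an $\mathrm{IPS}_{\mathrm{LIN}}$ refutation of $f=\sum_ix_iy_i-\beta$ together with the boolean axioms is a polynomial $C(\overline{x},\overline{y},u,\overline{z},\overline{z}')$ over $\mathbb{F}$ ($u$ a placeholder variable for $f$, and $z_i,z_i'$ placeholders for $x_i^2-x_i$, $y_i^2-y_i$), linear in $(u,\overline{z},\overline{z}')$, with $C(\overline{x},\overline{y},0,\overline{0},\overline{0})=0$ and $C(\overline{x},\overline{y},f,\overline{x}^2-\overline{x},\overline{y}^2-\overline{y})=1$ as polynomial identities. For a class $\mathcal{C}$ of circuits, it is a $\mathcal{C}$-$\mathrm{IPS}_{\mathrm{LIN}}$ refutation of given size/width if $C$ is computed in $\mathcal{C}$ with that size/width. A width-$r$ read-once oblivious algebraic branching program (roABP) on $N$ variables in variable order $v_1<\cdots<v_N$ is a directed acyclic graph with vertex layers $V_0=\{s\},V_1,\ldots,V_N=\{t\}$,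 $|V_i|\le r$, edges only from $V_{i-1}$ to $V_i$, each edge from $V_{i-1}$ to $V_i$ labelled by a univariate polynomial in $v_i$; it computes the sum over all $s$–$t$ paths of the product of edge labels. "Reads $\overline{x}$ before $\overline{y}$" means every $x_i$ precedes every $y_j$ in the order. A depth-3 powering ($\sum\bigwedge\sum$) formula on $N$ variables is an expression $\sum_{i=1}^{s}\ell_i^{d_i}$ with $\ell_i$ affine linear functions; its size is $N\cdot\sum_{i=1}^s(d_i+1)$. Integers are viewed as elements of $\mathbb{F}$; unsatisfiable means no common zero. Convention: $\mathrm{char}(\mathbb{F})>n$ includes characteristic zero. The implied constant in $\Omega$ is absolute and positive. *)

theory Defs
  imports "HOL-Library.Poly_Mapping" "HOL-Computational_Algebra.Polynomial" Complex_Main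
begin

text \<open>Multivariate polynomials: finitely supported coefficient functions on finitely
  supported exponent vectors.\<close>

type_synonym ('v, 'a) mpoly = "('v \<Rightarrow>\<^sub>0 nat) \<Rightarrow>\<^sub>0 'a"

definition Const :: "'a::zero \<Rightarrow> ('v, 'a) mpoly" where
  "Const c = Poly_Mapping.single 0 c"

definition Var :: "'v \<Rightarrow> ('v, 'a::zero_neq_one) mpoly" where
  "Var v = Poly_Mapping.single (Poly_Mapping.single v 1) 1"

definition mpoly_vars :: "('v, 'a::zero) mpoly \<Rightarrow> 'v set" where
  "mpoly_vars p = (\<Union>m\<in>Poly_Mapping.keys p. Poly_Mapping.keys m)"

definition mpoly_hom :: "('a::zero \<Rightarrow> 'b) \<Rightarrow> ('v \<Rightarrow> 'b) \<Rightarrow> ('v, 'a) mpoly \<Rightarrow> 'b::comm_semiring_1" where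
  "mpoly_hom \<phi> \<sigma> p = (\<Sum>m\<in>Poly_Mapping.keys p.
     \<phi> (Poly_Mapping.lookup p m) * (\<Prod>v\<in>Poly_Mapping.keys m. \<sigma> v ^ Poly_Mapping.lookup m v))"

abbreviation mpoly_eval :: "('v \<Rightarrow> 'a) \<Rightarrow> ('v, 'a::comm_semiring_1) mpoly \<Rightarrow> 'a" where
  "mpoly_eval \<equiv> mpoly_hom (\<lambda>c. c)"

abbreviation mpoly_subst :: "('v \<Rightarrow> ('w, 'a) mpoly) \<Rightarrow> ('v, 'a::comm_semiring_1) mpoly \<Rightarrow> ('w, 'a) mpoly" where
  "mpoly_subst \<equiv> mpoly_hom Const"

definition univariate_in :: "'v \<Rightarrow> 'a::comm_semiring_1 poly \<Rightarrow> ('v, 'a) mpoly" where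
  "univariate_in v q = (\<Sum>i\<le>degree q. Const (coeff q i) * Var v ^ i)"


section \<open>The system and its refutations\<close>

text \<open>\<open>U\<close> is the placeholder for \<open>f\<close>; \<open>Z i\<close> and \<open>Z' i\<close> are the placeholders for the boolean
  axioms of \<open>X i\<close> and \<open>Y i\<close>. The indices in use are \<open>1, \<dots>, n\<close>.\<close>

datatype ips_var = X nat | Y nat | U | Z nat | Z' nat

definition placeholders :: "nat \<Rightarrow> ips_var set" where
  "placeholders n = {U} \<union> Z ` {1..n} \<union> Z' ` {1..n}"

definition ips_vars :: "nat \<Rightarrow> ips_var set" where
  "ips_vars n = X ` {1..n} \<union> Y ` {1..n} \<union> placeholders n"

definition ip_poly :: "nat \<Rightarrow> 'a::field \<Rightarrow> (ips_var, 'a) mpoly" where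
  "ip_poly n \<beta> = (\<Sum>i=1..n. Var (X i) * Var (Y i)) - Const \<beta>"

definition bool_axiom :: "ips_var \<Rightarrow> (ips_var, 'a::field) mpoly" where
  "bool_axiom v = Var v ^ 2 - Var v"

definition ip_system :: "nat \<Rightarrow> 'a::field \<Rightarrow> (ips_var, 'a) mpoly set" where
  "ip_system n \<beta> = {ip_poly n \<beta>} \<union> (\<lambda>i. bool_axiom (X i)) ` {1..n} \<union> (\<lambda>i. bool_axiom (Y i)) ` {1..n}"

definition unsatisfiable :: "('v, 'a::field) mpoly set \<Rightarrow> bool" where
  "unsatisfiable S \<longleftrightarrow> \<not> (\<exists>a. \<forall>p\<in>S. mpoly_eval a p = 0)"

fun zero_subst :: "ips_var \<Rightarrow> (ips_var, 'a::field) mpoly" where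
  "zero_subst (X i) = Var (X i)"
| "zero_subst (Y i) = Var (Y i)"
| "zero_subst U = 0"
| "zero_subst (Z i) = 0"
| "zero_subst (Z' i) = 0"

fun axiom_subst :: "nat \<Rightarrow> 'a::field \<Rightarrow> ips_var \<Rightarrow> (ips_var, 'a) mpoly" where
  "axiom_subst n \<beta> (X i) = Var (X i)"
| "axiom_subst n \<beta> (Y i) = Var (Y i)"
| "axiom_subst n \<beta> U = ip_poly n \<beta>"
| "axiom_subst n \<beta> (Z i) = bool_axiom (X i)"
| "axiom_subst n \<beta> (Z' i) = bool_axiom (Y i)"

text \<open>Linearity is joint: every monomial has total degree at most one in the placeholders.\<close>

definition linear_in :: "'v set \<Rightarrow> ('v, 'a::zero) mpoly \<Rightarrow> bool" where
  "linear_in V p \<longleftrightarrow> (\<forall>m\<in>Poly_Mapping.keys p. (\<Sum>v\<in>V. Poly_Mapping.lookup m v) \<le> 1)"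

definition IPS_LIN_refutation :: "nat \<Rightarrow> 'a::field \<Rightarrow> (ips_var, 'a) mpoly \<Rightarrow> bool" where
  "IPS_LIN_refutation n \<beta> C \<longleftrightarrow>
     mpoly_vars C \<subseteq> ips_vars n \<and>
     linear_in (placeholders n) C \<and>
     mpoly_subst zero_subst C = 0 \<and>
     mpoly_subst (axiom_subst n \<beta>) C = 1"


section \<open>Read-once oblivious algebraic branching programs\<close>

record (overloaded) ('w, 'v, 'a) roabp =
  var_order :: "'v list"
  layer :: "nat \<Rightarrow> 'w set"
  edges :: "('w \<times> 'w) set"
  label :: "'w \<Rightarrow> 'w \<Rightarrow> 'a poly"

text \<open>Variables are numbered from \<open>0\<close> by \<open>var_order\<close>, so edges from layer \<open>i\<close> to
  layer \<open>Suc i\<close> read \<open>var_order A ! i\<close>.\<close>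

definition wf_roabp :: "'v set \<Rightarrow> ('w, 'v, 'a::field) roabp \<Rightarrow> bool" where
  "wf_roabp V A \<longleftrightarrow> (let N = length (var_order A) in
     distinct (var_order A) \<and> set (var_order A) = V \<and>
     (\<forall>i\<le>N. finite (layer A i)) \<and>
     (\<forall>i\<le>N. \<forall>j\<le>N. i \<noteq> j \<longrightarrow> layer A i \<inter> layer A j = {}) \<and>
     (\<exists>s. layer A 0 = {s}) \<and> (\<exists>t. layer A N = {t}) \<and>
     edges A \<subseteq> (\<Union>i<N. layer A i \<times> layer A (Suc i)))"

definition roabp_width_le :: "('w, 'v, 'a) roabp \<Rightarrow> nat \<Rightarrow> bool" where
  "roabp_width_le A r \<longleftrightarrow> (\<forall>i\<le>length (var_order A). card (layer A i) \<le> r)"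

text \<open>The paths from the source to the sink, as vertex sequences.\<close>

definition roabp_paths :: "('w, 'v, 'a) roabp \<Rightarrow> 'w list set" where
  "roabp_paths A = (let N = length (var_order A) in
     {p. length p = Suc N \<and> (\<forall>i\<le>N. p ! i \<in> layer A i) \<and>
         (\<forall>i<N. (p ! i, p ! Suc i) \<in> edges A)})"

definition roabp_poly :: "('w, 'v, 'a::field) roabp \<Rightarrow> ('v, 'a) mpoly" where
  "roabp_poly A = (\<Sum>p\<in>roabp_paths A. \<Prod>i<length (var_order A).
     univariate_in (var_order A ! i) (label A (p ! i) (p ! Suc i)))"

definition reads_before :: "'v set \<Rightarrow> 'v set \<Rightarrow> 'v list \<Rightarrow> bool" where
  "reads_before V W vs \<longleftrightarrow>
     (\<forall>i<length vs. \<forall>j<length vs. vs ! i \<in> V \<and> vs ! j \<in> W \<longrightarrow> i < j)"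


section \<open>Depth-3 powering formulas\<close>

text \<open>A summand \<open>(b, a, d)\<close> stands for the \<open>d\<close>-th power of the affine function with constant
  term \<open>b\<close> and linear coefficients \<open>a\<close> on the variable set \<open>V\<close>.\<close>

type_synonym ('v, 'a) powering_formula = "('a \<times> ('v \<Rightarrow> 'a) \<times> nat) list"

definition powering_poly :: "'v set \<Rightarrow> ('v, 'a::field) powering_formula \<Rightarrow> ('v, 'a) mpoly" where
  "powering_poly V F = (\<Sum>(b, a, d)\<leftarrow>F. (Const b + (\<Sum>v\<in>V. Const (a v) * Var v)) ^ d)"

definition powering_size :: "'v set \<Rightarrow> ('v, 'a) powering_formula \<Rightarrow> nat" where
  "powering_size V F = card V * (\<Sum>(b, a, d)\<leftarrow>F. d + 1)"


text \<open>The constant implied by \<open>\<Omega>(n)\<close> is absolute. As HOL has no quantification over types, a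
  constant bound inside a statement about fields \<open>'a\<close> could depend on \<open>'a\<close>; a closed real
  cannot depend on the field, \<open>n\<close> or \<open>\<beta>\<close>. Any value in \<open>(0, ln 2]\<close> would serve.\<close>

definition Omega_const :: real where
  "Omega_const = 1 / 2"

end

theory Submission
  imports Defs
begin

text \<open>Write \<open>f = \<Sum>\<^sub>i x\<^sub>i y\<^sub>i - \<beta>\<close>. Setting all placeholders \<open>z\<^sub>i, z'\<^sub>i\<close> to \<open>0\<close> and \<open>u\<close> to \<open>1\<close> in a
  refutation \<open>C\<close> gives, by linearity, a polynomial \<open>g(x, y)\<close> with \<open>g \<cdot> f = 1\<close> on the boolean cube, so
  that \<open>g(1\<^sub>T, 1\<^sub>S) = 1 / (\<bar>T \<inter> S\<bar> - \<beta>)\<close>. The matrix with these entries has full rank \<open>2\<^sup>n\<close>: by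
  inclusion-exclusion it factors through the inclusion matrix and a diagonal matrix with entries
  \<open>\<plusminus> m! / \<Prod>\<^bsub>j\<le>m\<^esub> (j - \<beta>)\<close>, which do not vanish when \<open>char F > n\<close>. A roABP reading \<open>x\<close> before \<open>y\<close>,
  cut at the layer after the last \<open>x\<^sub>i\<close>, bounds the rank by its width; the binomial theorem bounds
  the rank of \<open>(a(x) + b(y))\<^sup>d\<close> by \<open>d + 1\<close>.\<close>

section \<open>Evaluation of multivariate polynomials\<close>

text \<open>Variables outside the support contribute zeroth powers, hence factors 1. Two monomials
  can thus be compared over one common index set.\<close>

lemma prod_power_superset:
  fixes \<sigma> :: "'v \<Rightarrow> 'a::comm_semiring_1"
  assumes "finite S" "Poly_Mapping.keys m \<subseteq> S"
  shows "(\<Prod>v\<in>Poly_Mapping.keys m. \<sigma> v ^ Poly_Mapping.lookup m v)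
       = (\<Prod>v\<in>S. \<sigma> v ^ Poly_Mapping.lookup m v)"
  using assms by (intro prod.mono_neutral_left) (auto simp: in_keys_iff)

lemma mpoly_eval_superset:
  fixes p :: "('v, 'a::comm_semiring_1) mpoly"
  assumes "finite S" "Poly_Mapping.keys p \<subseteq> S"
  shows "mpoly_eval \<sigma> p = (\<Sum>m\<in>S. Poly_Mapping.lookup p m *
           (\<Prod>v\<in>Poly_Mapping.keys m. \<sigma> v ^ Poly_Mapping.lookup m v))"
  unfolding mpoly_hom_def using assms by (intro sum.mono_neutral_left) (auto simp: in_keys_iff)

lemma mpoly_eval_0 [simp]: "mpoly_eval \<sigma> 0 = 0"
  by (simp add: mpoly_hom_def)

lemma mpoly_eval_single:
  "mpoly_eval \<sigma> (Poly_Mapping.single m c) =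
     c * (\<Prod>v\<in>Poly_Mapping.keys m. \<sigma> v ^ Poly_Mapping.lookup m v)"
  by (simp add: mpoly_hom_def)

lemma mpoly_eval_Const [simp]: "mpoly_eval \<sigma> (Const c) = c"
  by (simp add: Const_def mpoly_eval_single)

lemma mpoly_eval_1 [simp]: "mpoly_eval \<sigma> 1 = 1"
  using mpoly_eval_Const[of \<sigma> 1] by (simp add: Const_def)

lemma mpoly_eval_Var [simp]: "mpoly_eval \<sigma> (Var v) = \<sigma> v"
  by (simp add: Var_def mpoly_eval_single)

lemma mpoly_eval_add [simp]: "mpoly_eval \<sigma> (p + q) = mpoly_eval \<sigma> p + mpoly_eval \<sigma> q"
proof -
  define S where "S = Poly_Mapping.keys p \<union> Poly_Mapping.keys q"
  have S: "finite S" "Poly_Mapping.keys p \<subseteq> S" "Poly_Mapping.keys q \<subseteq> S"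
    "Poly_Mapping.keys (p + q) \<subseteq> S"
    using keys_add[of p q] by (auto simp: S_def)
  show ?thesis
    by (simp add: mpoly_eval_superset[OF S(1,2)] mpoly_eval_superset[OF S(1,3)]
        mpoly_eval_superset[OF S(1,4)] lookup_add distrib_right sum.distrib)
qed

lemma mpoly_eval_sum [simp]: "mpoly_eval \<sigma> (\<Sum>i\<in>I. f i) = (\<Sum>i\<in>I. mpoly_eval \<sigma> (f i))"
  by (induction I rule: infinite_finite_induct) auto

lemma mpoly_eval_single_mult_single:
  "mpoly_eval \<sigma> (Poly_Mapping.single m c * Poly_Mapping.single m' c') =
     mpoly_eval \<sigma> (Poly_Mapping.single m c) * mpoly_eval \<sigma> (Poly_Mapping.single m' c')"
proof -
  define S where "S = Poly_Mapping.keys m \<union> Poly_Mapping.keys m'"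
  have S: "finite S" "Poly_Mapping.keys m \<subseteq> S" "Poly_Mapping.keys m' \<subseteq> S"
    "Poly_Mapping.keys (m + m') \<subseteq> S"
    using keys_add[of m m'] by (auto simp: S_def)
  show ?thesis
    unfolding mult_single mpoly_eval_single prod_power_superset[OF S(1,2)]
      prod_power_superset[OF S(1,3)] prod_power_superset[OF S(1,4)]
    by (simp add: lookup_add power_add prod.distrib ac_simps)
qed

lemma poly_mapping_eq_sum_single:
  "p = (\<Sum>m\<in>Poly_Mapping.keys p. Poly_Mapping.single m (Poly_Mapping.lookup p m))"
  by (rule poly_mapping_eqI) (simp add: lookup_sum lookup_single when_def in_keys_iff)

text \<open>Both factors are expanded into monomials; bilinearity leaves only products of two
  monomials, where exponents add.\<close>

lemma mpoly_eval_mult [simp]: "mpoly_eval \<sigma> (p * q) = mpoly_eval \<sigma> p * mpoly_eval \<sigma> q"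
proof -
  let ?s = "\<lambda>p m. Poly_Mapping.single m (Poly_Mapping.lookup p m)"
  have "mpoly_eval \<sigma> ((\<Sum>m\<in>Poly_Mapping.keys p. ?s p m) * (\<Sum>m\<in>Poly_Mapping.keys q. ?s q m)) =
      mpoly_eval \<sigma> (\<Sum>m\<in>Poly_Mapping.keys p. ?s p m) *
      mpoly_eval \<sigma> (\<Sum>m\<in>Poly_Mapping.keys q. ?s q m)"
    by (simp add: sum_product mpoly_eval_single_mult_single)
  then show ?thesis
    by (simp flip: poly_mapping_eq_sum_single)
qed

lemma mpoly_eval_prod [simp]: "mpoly_eval \<sigma> (\<Prod>i\<in>I. f i) = (\<Prod>i\<in>I. mpoly_eval \<sigma> (f i))"
  by (induction I rule: infinite_finite_induct) auto

lemma mpoly_eval_power [simp]: "mpoly_eval \<sigma> (p ^ k) = mpoly_eval \<sigma> p ^ k"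
  by (induction k) auto

lemma mpoly_eval_diff [simp]:
  fixes p :: "('v, 'a::comm_ring_1) mpoly"
  shows "mpoly_eval \<sigma> (p - q) = mpoly_eval \<sigma> p - mpoly_eval \<sigma> q"
  using mpoly_eval_add[of \<sigma> "p - q" q] by (simp add: algebra_simps)

lemma mpoly_eval_subst: "mpoly_eval \<sigma> (mpoly_subst s p) = mpoly_eval (\<lambda>v. mpoly_eval \<sigma> (s v)) p"
  by (simp add: mpoly_hom_def[of Const] mpoly_hom_def[of "\<lambda>c. c" "\<lambda>v. mpoly_eval \<sigma> (s v)"])

lemma mpoly_eval_univariate_in: "mpoly_eval \<sigma> (univariate_in v q) = poly q (\<sigma> v)"
  by (simp add: univariate_in_def poly_altdef)

text \<open>Each monomial has degree at most 1 in \<open>u\<close>, so the evaluation is an affine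
  function of the value at \<open>u\<close>. It vanishes at 0 and is therefore linear.\<close>

lemma mpoly_eval_linear_update:
  fixes p :: "('v, 'a::comm_ring_1) mpoly"
  assumes "linear_in V p" "finite V" "u \<in> V" "mpoly_eval (\<sigma>(u := 0)) p = 0"
  shows "mpoly_eval (\<sigma>(u := c)) p = c * mpoly_eval (\<sigma>(u := 1)) p"
proof -
  \<comment> \<open>Isolates the dependence on the value \<open>b\<close> at \<open>u\<close>; a
    monomial without \<open>u\<close> is covered through the exponent 0.\<close>
  have split: "(\<Prod>v\<in>Poly_Mapping.keys m. (\<sigma>(u := b)) v ^ Poly_Mapping.lookup m v) =
      b ^ Poly_Mapping.lookup m u *
      (\<Prod>v\<in>Poly_Mapping.keys m - {u}. \<sigma> v ^ Poly_Mapping.lookup m v)" for b m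
  proof -
    have "(\<Prod>v\<in>insert u (Poly_Mapping.keys m). (\<sigma>(u := b)) v ^ Poly_Mapping.lookup m v) =
      b ^ Poly_Mapping.lookup m u *
      (\<Prod>v\<in>Poly_Mapping.keys m - {u}. (\<sigma>(u := b)) v ^ Poly_Mapping.lookup m v)"
      by (subst prod.insert_remove) auto
    also have "(\<Prod>v\<in>Poly_Mapping.keys m - {u}. (\<sigma>(u := b)) v ^ Poly_Mapping.lookup m v) =
        (\<Prod>v\<in>Poly_Mapping.keys m - {u}. \<sigma> v ^ Poly_Mapping.lookup m v)"
      by (rule prod.cong) auto
    finally show ?thesis
      by (subst prod_power_superset[where S = "insert u (Poly_Mapping.keys m)"]) auto
  qed
  have deg: "Poly_Mapping.lookup m u \<le> 1" if "m \<in> Poly_Mapping.keys p" for m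
    using assms(1-3) that member_le_sum[of u V "Poly_Mapping.lookup m"]
    by (fastforce simp: linear_in_def)
  have "mpoly_eval (\<sigma>(u := c)) p =
      (1 - c) * mpoly_eval (\<sigma>(u := 0)) p + c * mpoly_eval (\<sigma>(u := 1)) p"
    unfolding mpoly_hom_def split sum_distrib_left sum.distrib[symmetric]
  proof (rule sum.cong)
    fix m assume "m \<in> Poly_Mapping.keys p"
    then have "Poly_Mapping.lookup m u = 0 \<or> Poly_Mapping.lookup m u = 1"
      using deg by fastforce
    \<comment> \<open>For exponent 0 all three powers are 1, \<open>0 ^ 0\<close> included, and the
      weights \<open>1 - c\<close> and \<open>c\<close> add up to 1; for exponent 1 only the last
      summand survives.\<close>
    then show "Poly_Mapping.lookup p m * (c ^ Poly_Mapping.lookup m u *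
          (\<Prod>v\<in>Poly_Mapping.keys m - {u}. \<sigma> v ^ Poly_Mapping.lookup m v)) =
        (1 - c) * (Poly_Mapping.lookup p m * (0 ^ Poly_Mapping.lookup m u *
          (\<Prod>v\<in>Poly_Mapping.keys m - {u}. \<sigma> v ^ Poly_Mapping.lookup m v))) +
        c * (Poly_Mapping.lookup p m * (1 ^ Poly_Mapping.lookup m u *
          (\<Prod>v\<in>Poly_Mapping.keys m - {u}. \<sigma> v ^ Poly_Mapping.lookup m v)))"
      by (auto simp: algebra_simps)
  qed simp
  with assms(4) show ?thesis by simp
qed


section \<open>The rank of the matrix \<open>1 / (\<bar>T \<inter> S\<bar> - \<beta>)\<close>\<close>

text \<open>Gaussian elimination: each equation that is not identically zero on \<open>A\<close> is
  used to remove one unknown, which keeps the unknowns in the majority.\<close>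

lemma exists_nontrivial_kernel:
  fixes R :: "'k \<Rightarrow> 's \<Rightarrow> 'a::field"
  assumes "finite K" "finite A" "card K < card A"
  shows "\<exists>v. (\<exists>s\<in>A. v s \<noteq> 0) \<and> (\<forall>k\<in>K. (\<Sum>s\<in>A. R k s * v s) = 0)"
  using assms
proof (induction K arbitrary: A R rule: finite_induct)
  case empty
  then have "\<exists>s. s \<in> A" by (metis card.empty equals0I less_irrefl)
  then show ?case by (intro exI[of _ "\<lambda>_. 1"]) auto
next
  case (insert k K)
  show ?case
  proof (cases "\<forall>s\<in>A. R k s = 0")
    case True
    from insert have "card K < card A" by simp
    from insert.IH[OF insert.prems(1) this, of R] obtain v where
      "\<exists>s\<in>A. v s \<noteq> 0" "\<forall>k\<in>K. (\<Sum>s\<in>A. R k s * v s) = 0" by blast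
    with True show ?thesis by (intro exI[of _ v]) auto
  next
    case False
    then obtain t where t: "t \<in> A" "R k t \<noteq> 0" by blast
    define B where "B = A - {t}"
    have A: "A = insert t B" "t \<notin> B" "finite B"
      using t insert.prems by (auto simp: B_def)
    with insert have "card K < card B" by simp
    \<comment> \<open>Row \<open>k\<close> is subtracted from every other row with the multiple that
      clears column \<open>t\<close>.\<close>
    from insert.IH[OF A(3) this, of "\<lambda>j s. R j s - R j t * R k s / R k t"] obtain v where
      v: "\<exists>s\<in>B. v s \<noteq> 0" "\<And>j. j \<in> K \<Longrightarrow> (\<Sum>s\<in>B. (R j s - R j t * R k s / R k t) * v s) = 0"
      by blast
    \<comment> \<open>Back substitution: the value of the unknown \<open>t\<close> that solves
      equation \<open>k\<close>.\<close>
    define a where "a = - (\<Sum>s\<in>B. R k s * v s) / R k t"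
    have sum: "(\<Sum>s\<in>A. R j s * (v(t := a)) s) = R j t * a + (\<Sum>s\<in>B. R j s * v s)" for j
    proof -
      have "(\<Sum>s\<in>B. R j s * (v(t := a)) s) = (\<Sum>s\<in>B. R j s * v s)"
        using A(2) by (intro sum.cong) auto
      then show ?thesis by (simp add: A)
    qed
    have "(\<Sum>s\<in>A. R j s * (v(t := a)) s) = 0" if "j \<in> insert k K" for j
    proof (cases "j = k")
      case True
      then show ?thesis unfolding sum using t by (simp add: a_def)
    next
      case False
      with that v(2) have "0 = (\<Sum>s\<in>B. (R j s - R j t * R k s / R k t) * v s)" by simp
      also have "\<dots> = (\<Sum>s\<in>B. R j s * v s) - R j t / R k t * (\<Sum>s\<in>B. R k s * v s)"
        by (simp add: sum_distrib_left left_diff_distrib sum_subtractf mult.assoc)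
      finally show ?thesis unfolding sum by (simp add: a_def)
    qed
    moreover have "\<exists>s\<in>A. (v(t := a)) s \<noteq> 0"
      using v(1) A by auto
    ultimately show ?thesis by blast
  qed
qed

section \<open>Alternating sums over the subsets of a finite set\<close>

lemma sum_Pow_insert:
  fixes f :: "'b set \<Rightarrow> 'a::comm_monoid_add"
  assumes "finite R" "x \<notin> R"
  shows "(\<Sum>T\<in>Pow (insert x R). f T) = (\<Sum>T\<in>Pow R. f T) + (\<Sum>T\<in>Pow R. f (insert x T))"
proof -
  have "inj_on (insert x) (Pow R)"
    using assms(2) by (intro inj_onI) (auto simp: insert_ident)
  then show ?thesis
    using assms by (subst Pow_insert, subst sum.union_disjoint) (auto simp: sum.reindex)
qed

text \<open>An iterated finite difference of 1/c. Subsets that contain the new element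
  \<open>x\<close> have the opposite sign and \<open>c\<close> shifted to \<open>c + 1\<close>, so
  the sum is the difference of the induction hypothesis at \<open>c\<close> and at
  \<open>c + 1\<close>.\<close>

lemma alternating_sum_inverse:
  fixes c :: "'a::field"
  assumes "finite R" "\<And>j. j \<le> card R \<Longrightarrow> c + of_nat j \<noteq> 0"
  shows "(\<Sum>T\<in>Pow R. (- 1) ^ card T / (c + of_nat (card T)))
       = of_nat (fact (card R)) / (\<Prod>j\<le>card R. c + of_nat j)"
  using assms
proof (induction R arbitrary: c rule: finite_induct)
  case (insert x R)
  let ?m = "card R"
  let ?P = "\<Prod>j\<le>?m. (c + 1) + of_nat j"
  let ?Q = "\<Prod>j\<le>?m. c + of_nat j"
  have nz: "c + of_nat j \<noteq> 0" if "j \<le> Suc ?m" for j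
    using insert.prems insert.hyps that by simp
  have nz': "(c + 1) + of_nat j \<noteq> 0" if "j \<le> ?m" for j
    using nz[of "Suc j"] that by (simp add: add.assoc)
  have c: "c \<noteq> 0" "c + of_nat (Suc ?m) \<noteq> 0"
    using nz[of 0] nz[of "Suc ?m"] by auto
  \<comment> \<open>The two denominators \<open>?P\<close> and \<open>?Q\<close> each lack one end
    factor of this product, which serves as common denominator.\<close>
  have whole: "(\<Prod>j\<le>Suc ?m. c + of_nat j) = c * ?P"
    unfolding prod.atMost_Suc_shift by (simp add: add.assoc)
  have whole': "(\<Prod>j\<le>Suc ?m. c + of_nat j) = ?Q * (c + of_nat (Suc ?m))"
    by (simp only: prod.atMost_Suc)
  have shift: "(- 1) ^ card (insert x T) / (c + of_nat (card (insert x T))) =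
      - ((- 1) ^ card T / ((c + 1) + of_nat (card T)))" if "T \<in> Pow R" for T
  proof -
    have "card (insert x T) = Suc (card T)"
      using that insert.hyps by (subst card_insert_disjoint) (auto intro: finite_subset)
    then show ?thesis by (simp add: add.assoc)
  qed
  have "(\<Sum>T\<in>Pow R. (- 1) ^ card (insert x T) / (c + of_nat (card (insert x T)))) =
      - (of_nat (fact ?m) / ?P)"
  proof -
    have "(\<Sum>T\<in>Pow R. (- 1) ^ card T / ((c + 1) + of_nat (card T))) = of_nat (fact ?m) / ?P"
      by (rule insert.IH) (rule nz')
    then show ?thesis using shift by (simp add: sum_negf)
  qed
  then have "(\<Sum>T\<in>Pow (insert x R). (- 1) ^ card T / (c + of_nat (card T))) =
      of_nat (fact ?m) / ?Q - of_nat (fact ?m) / ?P"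
    unfolding sum_Pow_insert[OF insert.hyps] by (simp add: insert.IH nz)
  also have "\<dots> = of_nat (fact ?m) * (c + of_nat (Suc ?m)) / (\<Prod>j\<le>Suc ?m. c + of_nat j)
      - of_nat (fact ?m) * c / (\<Prod>j\<le>Suc ?m. c + of_nat j)"
  proof -
    have "b / ?Q = b * (c + of_nat (Suc ?m)) / (\<Prod>j\<le>Suc ?m. c + of_nat j)" for b :: 'a
      unfolding whole' using c by simp
    moreover have "b / ?P = b * c / (\<Prod>j\<le>Suc ?m. c + of_nat j)" for b :: 'a
      unfolding whole using c by simp
    ultimately show ?thesis by simp
  qed
  \<comment> \<open>The difference \<open>c + of_nat (Suc ?m) - c\<close> supplies the factor that
    turns m! into (m+1)!.\<close>
  also have "\<dots> = of_nat (fact (Suc ?m)) / (\<Prod>j\<le>Suc ?m. c + of_nat j)"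
    by (simp add: algebra_simps flip: diff_divide_distrib)
  finally show ?case using insert.hyps by simp
qed simp

text \<open>If some x in \<open>R\<close> lies outside \<open>S\<close>, adding x to
  \<open>T\<close> flips the sign but keeps \<open>T \<inter> S\<close>, so the terms cancel in
  pairs.\<close>

lemma alternating_sum_Int:
  fixes h :: "nat \<Rightarrow> 'a::comm_ring_1"
  assumes "finite R"
  shows "(\<Sum>T\<in>Pow R. (- 1) ^ card T * h (card (T \<inter> S))) =
     (if R \<subseteq> S then \<Sum>T\<in>Pow R. (- 1) ^ card T * h (card T) else 0)"
proof (cases "R \<subseteq> S")
  case True
  then show ?thesis
    by (auto intro!: sum.cong simp: Int_absorb2 subset_trans)
next
  case False
  then obtain x where x: "x \<in> R" "x \<notin> S" by blast
  define Q where "Q = R - {x}"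
  have Q: "R = insert x Q" "x \<notin> Q" "finite Q"
    using x assms by (auto simp: Q_def)
  have "(- 1) ^ card (insert x T) * h (card (insert x T \<inter> S)) =
      - ((- 1) ^ card T * h (card (T \<inter> S)))" if "T \<in> Pow Q" for T
  proof -
    have "card (insert x T) = Suc (card T)"
      using that Q by (subst card_insert_disjoint) (auto intro: finite_subset)
    then show ?thesis using x by simp
  qed
  then have "(\<Sum>T\<in>Pow Q. (- 1) ^ card (insert x T) * h (card (insert x T \<inter> S))) =
      - (\<Sum>T\<in>Pow Q. (- 1) ^ card T * h (card (T \<inter> S)))"
    by (simp add: sum_negf)
  then show ?thesis
    unfolding Q(1) sum_Pow_insert[OF Q(3,2)] using x by simp
qed

text \<open>The index set \<open>K\<close> is the inner dimension of a factorization of the matrix.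
  If it were too small, a non-zero \<open>v\<close> would be annihilated by the right factor, hence
  by the matrix; Moebius inversion over the rows then forces \<open>v\<close> to vanish.\<close>

lemma rank_inverse_Int:
  fixes \<beta> :: "'a::field" and L R :: "'k \<Rightarrow> nat set \<Rightarrow> 'a"
  assumes char: "CHAR('a) = 0 \<or> CHAR('a) > n"
    and \<beta>: "\<beta> \<notin> of_nat ` {0..n}"
    and K: "finite K"
    and M: "\<And>T S. T \<subseteq> {1..n} \<Longrightarrow> S \<subseteq> {1..n} \<Longrightarrow>
      (of_nat (card (T \<inter> S)) - \<beta>) * (\<Sum>k\<in>K. L k T * R k S) = 1"
  shows "2 ^ n \<le> card K"
proof (rule ccontr)
  assume "\<not> ?thesis"
  then have "card K < card (Pow {1..n})" by (simp add: card_Pow)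
  from exists_nontrivial_kernel[OF K _ this, of R] obtain v where
    nontrivial: "\<exists>S\<in>Pow {1..n}. v S \<noteq> 0" and
    ker: "\<And>k. k \<in> K \<Longrightarrow> (\<Sum>S\<in>Pow {1..n}. R k S * v S) = 0"
    by auto
  define h where "h j = 1 / (- \<beta> + of_nat j)" for j
  have M': "(\<Sum>k\<in>K. L k T * R k S) = h (card (T \<inter> S))"
    if "T \<subseteq> {1..n}" "S \<subseteq> {1..n}" for T S
  proof -
    from M[OF that] have "of_nat (card (T \<inter> S)) - \<beta> \<noteq> 0" by auto
    with M[OF that] show ?thesis by (simp add: h_def eq_divide_eq mult.commute)
  qed
  have Mv: "(\<Sum>S\<in>Pow {1..n}. h (card (T \<inter> S)) * v S) = 0" if "T \<subseteq> {1..n}" for T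
  proof -
    have "(\<Sum>S\<in>Pow {1..n}. h (card (T \<inter> S)) * v S) =
        (\<Sum>S\<in>Pow {1..n}. \<Sum>k\<in>K. L k T * (R k S * v S))"
    proof (rule sum.cong)
      fix S assume "S \<in> Pow {1..n}"
      then have "h (card (T \<inter> S)) = (\<Sum>k\<in>K. L k T * R k S)"
        using M' that by simp
      then show "h (card (T \<inter> S)) * v S = (\<Sum>k\<in>K. L k T * (R k S * v S))"
        by (simp add: sum_distrib_right mult.assoc)
    qed simp
    also have "\<dots> = (\<Sum>k\<in>K. L k T * (\<Sum>S\<in>Pow {1..n}. R k S * v S))"
      by (subst sum.swap) (simp add: sum_distrib_left)
    finally show ?thesis using ker by simp
  qed
  \<comment> \<open>The alternating combination of the rows \<open>T \<subseteq> Q\<close> is a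
    multiple of the indicator of the supersets of \<open>Q\<close>. It remains to see that the
    multiple \<open>?\<mu>\<close> is not 0.\<close>
  have up: "(\<Sum>S\<in>{S\<in>Pow {1..n}. Q \<subseteq> S}. v S) = 0" if Q: "Q \<subseteq> {1..n}" for Q
  proof -
    have finQ: "finite Q" and cardQ: "card Q \<le> n"
      using Q card_mono[OF _ Q] finite_subset by auto
    let ?\<mu> = "\<Sum>T\<in>Pow Q. (- 1) ^ card T * h (card T)"
    have nz: "- \<beta> + of_nat j \<noteq> 0" if "j \<le> card Q" for j
      using \<beta> that cardQ by (auto simp: image_iff)
    \<comment> \<open>Every factor of the factorial lies between 1 and n, so a positive
      characteristic above n divides none of them.\<close>
    have "(of_nat (fact (card Q)) :: 'a) \<noteq> 0"
      unfolding fact_prod of_nat_id of_nat_prod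
      using char cardQ by (auto simp: of_nat_eq_0_iff_char_dvd dest: dvd_imp_le)
    then have "?\<mu> \<noteq> 0"
      using alternating_sum_inverse[OF finQ nz] nz by (simp add: h_def)
    have "0 = (\<Sum>T\<in>Pow Q. (- 1) ^ card T * (\<Sum>S\<in>Pow {1..n}. h (card (T \<inter> S)) * v S))"
      using Q by (intro sum.neutral[symmetric] ballI) (subst Mv, auto)
    also have "\<dots> = (\<Sum>S\<in>Pow {1..n}. (\<Sum>T\<in>Pow Q. (- 1) ^ card T * h (card (T \<inter> S))) * v S)"
      unfolding sum_distrib_left sum_distrib_right by (subst sum.swap) (simp add: mult.assoc)
    also have "\<dots> = (\<Sum>S\<in>Pow {1..n}. if Q \<subseteq> S then ?\<mu> * v S else 0)"
      unfolding alternating_sum_Int[OF finQ, of h] by (intro sum.cong) auto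
    also have "\<dots> = ?\<mu> * (\<Sum>S\<in>{S\<in>Pow {1..n}. Q \<subseteq> S}. v S)"
      by (simp add: sum.If_cases sum_distrib_left Int_def)
    finally show ?thesis using \<open>?\<mu> \<noteq> 0\<close> by simp
  qed
  \<comment> \<open>For a maximal set \<open>Q\<close> in the support of \<open>v\<close>, the sum
    over the supersets of \<open>Q\<close> consists of the single term \<open>v Q\<close>.\<close>
  have "finite {S\<in>Pow {1..n}. v S \<noteq> 0}" "{S\<in>Pow {1..n}. v S \<noteq> 0} \<noteq> {}"
    using nontrivial by auto
  from finite_has_maximal[OF this] obtain Q where Q: "Q \<in> {S\<in>Pow {1..n}. v S \<noteq> 0}"
    and max: "\<forall>S\<in>{S\<in>Pow {1..n}. v S \<noteq> 0}. Q \<subseteq> S \<longrightarrow> Q = S"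
    by (rule bexE)
  have "(\<Sum>S\<in>{S\<in>Pow {1..n}. Q \<subseteq> S}. v S) = (\<Sum>S\<in>{Q}. v S)"
    using Q max by (intro sum.mono_neutral_right) auto
  with up[of Q] Q show False by simp
qed

text \<open>After squaring, exp (1/2) \<le> 2 becomes e \<le> 4, which follows from e \<le>
  3.\<close>

lemma exp_Omega_const_le: "exp (Omega_const * real n) \<le> 2 ^ n"
proof -
  have "exp (1 / 2 :: real) ^ 2 \<le> 2 ^ 2"
    using exp_le by (simp flip: exp_of_nat_mult)
  then have "exp (1 / 2 :: real) \<le> 2"
    by (rule power2_le_imp_le) simp
  then have "exp (1 / 2 :: real) ^ n \<le> 2 ^ n"
    by (rule power_mono) simp
  then show ?thesis
    by (simp add: Omega_const_def flip: exp_of_nat_mult)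
qed


section \<open>Refutations on the boolean cube\<close>

text \<open>The value 0 at \<open>Z\<close> and \<open>Z'\<close> is that of the boolean axioms on
  the cube; the value 1 at \<open>U\<close> reads off the part of a refutation that is linear in
  \<open>U\<close>.\<close>

fun cube_point :: "nat set \<Rightarrow> nat set \<Rightarrow> ips_var \<Rightarrow> 'a::field" where
  "cube_point T S (X i) = of_bool (i \<in> T)"
| "cube_point T S (Y i) = of_bool (i \<in> S)"
| "cube_point T S U = 1"
| "cube_point T S (Z i) = 0"
| "cube_point T S (Z' i) = 0"

lemma mpoly_eval_ip_poly_cube_point:
  assumes "T \<subseteq> {1..n}"
  shows "mpoly_eval (cube_point T S) (ip_poly n \<beta>) = of_nat (card (T \<inter> S)) - \<beta>"
proof -
  have "(\<Sum>i=1..n. of_bool (i \<in> T) * of_bool (i \<in> S)) = (\<Sum>i\<in>T \<inter> S. 1 :: 'a)"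
    using assms by (intro sum.mono_neutral_cong_right) auto
  then show ?thesis by (simp add: ip_poly_def)
qed

text \<open>Both identities that define a refutation become evaluations of \<open>C\<close> at
  points differing from \<open>cube_point T S\<close> only in \<open>U\<close>, with the values 0
  and f. Linearity in \<open>U\<close> relates them to the value 1.\<close>

lemma refutation_eval_cube_point:
  fixes C :: "(ips_var, 'a::field) mpoly"
  assumes C: "IPS_LIN_refutation n \<beta> C" and T: "T \<subseteq> {1..n}"
  shows "(of_nat (card (T \<inter> S)) - \<beta>) * mpoly_eval (cube_point T S) C = 1"
proof -
  let ?\<sigma> = "cube_point T S :: ips_var \<Rightarrow> 'a"
  have "(\<lambda>v. mpoly_eval ?\<sigma> (zero_subst v)) = ?\<sigma>(U := 0)"
  proof
    fix v show "mpoly_eval ?\<sigma> (zero_subst v) = (?\<sigma>(U := 0)) v" by (cases v) auto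
  qed
  moreover have "mpoly_eval ?\<sigma> (mpoly_subst zero_subst C) = 0"
    using C by (simp add: IPS_LIN_refutation_def)
  ultimately have "mpoly_eval (?\<sigma>(U := 0)) C = 0"
    by (simp add: mpoly_eval_subst)
  then have "mpoly_eval (?\<sigma>(U := c)) C = c * mpoly_eval (?\<sigma>(U := 1)) C" for c
    using C by (intro mpoly_eval_linear_update[of "placeholders n"])
      (auto simp: IPS_LIN_refutation_def placeholders_def)
  moreover have "?\<sigma>(U := 1) = ?\<sigma>"
    by (simp add: fun_upd_idem)
  moreover have "(\<lambda>v. mpoly_eval ?\<sigma> (axiom_subst n \<beta> v)) =
      ?\<sigma>(U := of_nat (card (T \<inter> S)) - \<beta>)"
  proof
    fix v show "mpoly_eval ?\<sigma> (axiom_subst n \<beta> v) = (?\<sigma>(U := of_nat (card (T \<inter> S)) - \<beta>)) v"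
      using mpoly_eval_ip_poly_cube_point[OF T, of S \<beta>]
      by (cases v) (auto simp: bool_axiom_def of_bool_def)
  qed
  moreover have "mpoly_eval ?\<sigma> (mpoly_subst (axiom_subst n \<beta>) C) = 1"
    using C by (simp add: IPS_LIN_refutation_def)
  ultimately show ?thesis
    by (simp add: mpoly_eval_subst)
qed

text \<open>A common zero has all coordinates x, y in {0,1}, so its inner product counts the indices
  where both are 1 and would make \<beta> one of 0, ..., n.\<close>

lemma unsatisfiable_ip_system:
  fixes \<beta> :: "'a::field"
  assumes "\<beta> \<notin> of_nat ` {0..n}"
  shows "unsatisfiable (ip_system n \<beta>)"
  unfolding unsatisfiable_def
proof
  assume "\<exists>a. \<forall>p\<in>ip_system n \<beta>. mpoly_eval a p = 0"
  then obtain a where a: "\<And>p. p \<in> ip_system n \<beta> \<Longrightarrow> mpoly_eval a p = 0" by blast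
  have bool: "a v = of_bool (a v = 1)" if "bool_axiom v \<in> ip_system n \<beta>" for v
  proof -
    have "a v * (a v - 1) = 0"
      using a[OF that] by (simp add: bool_axiom_def power2_eq_square algebra_simps)
    then show ?thesis by auto
  qed
  let ?A = "{i\<in>{1..n}. a (X i) = 1 \<and> a (Y i) = 1}"
  have "(\<Sum>i=1..n. a (X i) * a (Y i)) = (\<Sum>i\<in>?A. 1)"
  proof (rule sum.mono_neutral_cong_right)
    show "\<forall>i\<in>{1..n} - ?A. a (X i) * a (Y i) = 0"
    proof
      fix i assume i: "i \<in> {1..n} - ?A"
      then have "bool_axiom (X i) \<in> ip_system n \<beta>" "bool_axiom (Y i) \<in> ip_system n \<beta>"
        by (auto simp: ip_system_def)
      with i bool[of "X i"] bool[of "Y i"] show "a (X i) * a (Y i) = 0"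
        by (auto simp: of_bool_def split: if_splits)
    qed
  qed auto
  moreover have "mpoly_eval a (ip_poly n \<beta>) = 0"
    by (rule a) (simp add: ip_system_def)
  ultimately have "\<beta> = of_nat (card ?A)"
    by (simp add: ip_poly_def)
  moreover have "card ?A \<le> card {1..n}"
    by (intro card_mono) auto
  ultimately show False using assms by auto
qed


section \<open>Rank bounds for roABPs and powering formulas\<close>

text \<open>The cut vertex \<open>w\<close> is both the last vertex of a prefix and the first of a
  suffix. Suffixes are indexed from 0, so position i lies in layer k + i.\<close>

definition path_prefixes :: "('w, 'v, 'a) roabp \<Rightarrow> nat \<Rightarrow> 'w \<Rightarrow> 'w list set" where
  "path_prefixes A k w = {p. length p = Suc k \<and> (\<forall>i\<le>k. p ! i \<in> layer A i) \<and>
     (\<forall>i<k. (p ! i, p ! Suc i) \<in> edges A) \<and> p ! k = w}"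

definition path_suffixes :: "('w, 'v, 'a) roabp \<Rightarrow> nat \<Rightarrow> 'w \<Rightarrow> 'w list set" where
  "path_suffixes A k w = (let d = length (var_order A) - k in
     {q. length q = Suc d \<and> (\<forall>i\<le>d. q ! i \<in> layer A (k + i)) \<and>
         (\<forall>i<d. (q ! i, q ! Suc i) \<in> edges A) \<and> q ! 0 = w})"

lemma finite_roabp_paths:
  assumes "wf_roabp V A"
  shows "finite (roabp_paths A)"
proof -
  let ?N = "length (var_order A)"
  have "roabp_paths A \<subseteq> {p. set p \<subseteq> (\<Union>i\<le>?N. layer A i) \<and> length p = Suc ?N}"
    unfolding roabp_paths_def Let_def by (fastforce simp: in_set_conv_nth less_Suc_eq_le)
  moreover have "finite (\<Union>i\<le>?N. layer A i)"
    using assms by (auto simp: wf_roabp_def Let_def)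
  ultimately show ?thesis
    using finite_lists_length_eq finite_subset by blast
qed

text \<open>A path through \<open>w\<close> is a prefix and a suffix chosen independently, and its
  weight is the product of theirs, so distributivity applies. The abstract weight \<open>W\<close>
  may depend on the position and the edge.\<close>

lemma sum_paths_through:
  fixes W :: "nat \<Rightarrow> 'w \<Rightarrow> 'w \<Rightarrow> 'b::comm_semiring_1" and A :: "('w, 'v, 'a) roabp"
  defines "N \<equiv> length (var_order A)"
  assumes k: "k \<le> N"
  shows "(\<Sum>p\<in>{p\<in>roabp_paths A. p ! k = w}. \<Prod>i<N. W i (p ! i) (p ! Suc i)) =
     (\<Sum>p\<in>path_prefixes A k w. \<Prod>i<k. W i (p ! i) (p ! Suc i)) *
     (\<Sum>q\<in>path_suffixes A k w. \<Prod>i<N - k. W (k + i) (q ! i) (q ! Suc i))"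
proof -
  have join: "p @ tl q \<in> {p\<in>roabp_paths A. p ! k = w}"
    if p: "p \<in> path_prefixes A k w" and q: "q \<in> path_suffixes A k w" for p q
  proof -
    have left: "(p @ tl q) ! i = p ! i" if "i \<le> k" for i
      using p that by (simp add: nth_append path_prefixes_def)
    \<comment> \<open>At i = 0 this holds because \<open>p\<close> ends in the vertex
      \<open>w\<close> with which \<open>q\<close> begins; \<open>tl\<close> drops the second
      copy.\<close>
    have right: "(p @ tl q) ! (k + i) = q ! i" if "i \<le> N - k" for i
      using p q that
      by (cases i) (auto simp: nth_append path_prefixes_def path_suffixes_def Let_def N_def nth_tl)
    have "(p @ tl q) ! i \<in> layer A i" if "i \<le> N" for i
    proof (cases "i \<le> k")
      case True
      then show ?thesis using p by (simp add: left path_prefixes_def)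
    next
      case False
      then show ?thesis using q right[of "i - k"] that
        by (auto simp: path_suffixes_def Let_def N_def dest: spec[of _ "i - k"])
    qed
    moreover have "((p @ tl q) ! i, (p @ tl q) ! Suc i) \<in> edges A" if "i < N" for i
    proof (cases "i < k")
      case True
      then show ?thesis using p left[of i] left[of "Suc i"] by (simp add: path_prefixes_def)
    next
      case False
      then show ?thesis using q right[of "i - k"] right[of "Suc (i - k)"] that
        by (auto simp: path_suffixes_def Let_def N_def dest: spec[of _ "i - k"])
    qed
    moreover have "length (p @ tl q) = Suc N"
      using p q k by (simp add: path_prefixes_def path_suffixes_def Let_def N_def)
    moreover have "(p @ tl q) ! k = w"
      using p left[of k] by (simp add: path_prefixes_def)
    ultimately show "p @ tl q \<in> {p\<in>roabp_paths A. p ! k = w}"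
      by (simp add: roabp_paths_def Let_def N_def)
  qed
  have "(\<Sum>p\<in>{p\<in>roabp_paths A. p ! k = w}. \<Prod>i<N. W i (p ! i) (p ! Suc i)) =
      (\<Sum>(p, q)\<in>path_prefixes A k w \<times> path_suffixes A k w.
        (\<Prod>i<k. W i (p ! i) (p ! Suc i)) * (\<Prod>i<N - k. W (k + i) (q ! i) (q ! Suc i)))"
  \<comment> \<open>\<open>take (Suc k)\<close> and \<open>drop k\<close> overlap in the vertex at
    position k, as prefixes and suffixes must.\<close>
  proof (rule sum.reindex_bij_witness[where i = "\<lambda>(p, q). p @ tl q"
        and j = "\<lambda>p. (take (Suc k) p, drop k p)"])
    fix p assume p: "p \<in> {p\<in>roabp_paths A. p ! k = w}"
    then have len: "length p = Suc N" by (simp add: roabp_paths_def Let_def N_def)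
    show "(case (take (Suc k) p, drop k p) of (p, q) \<Rightarrow> p @ tl q) = p"
      by (simp add: tl_drop drop_Suc[symmetric])
    show "(take (Suc k) p, drop k p) \<in> path_prefixes A k w \<times> path_suffixes A k w"
      using p len k
      by (auto simp: roabp_paths_def path_prefixes_def path_suffixes_def Let_def N_def)
    have "(\<Prod>i<N. W i (p ! i) (p ! Suc i)) =
        (\<Prod>i<k. W i (p ! i) (p ! Suc i)) * (\<Prod>i=k..<N. W i (p ! i) (p ! Suc i))"
      using k by (simp add: lessThan_atLeast0 prod.atLeastLessThan_concat)
    also have "(\<Prod>i=k..<N. W i (p ! i) (p ! Suc i)) =
        (\<Prod>i<N - k. W (k + i) (p ! (k + i)) (p ! Suc (k + i)))"
      using k by (simp add: lessThan_atLeast0 prod.atLeastLessThan_shift_0[of _ k N] add.commute)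
    finally show "(case (take (Suc k) p, drop k p) of (p, q) \<Rightarrow>
        (\<Prod>i<k. W i (p ! i) (p ! Suc i)) * (\<Prod>i<N - k. W (k + i) (q ! i) (q ! Suc i))) =
      (\<Prod>i<N. W i (p ! i) (p ! Suc i))"
      using len k by simp
  next
    fix b assume b: "b \<in> path_prefixes A k w \<times> path_suffixes A k w"
    then obtain p q where pq: "b = (p, q)" "p \<in> path_prefixes A k w" "q \<in> path_suffixes A k w"
      by blast
    show "(case b of (p, q) \<Rightarrow> p @ tl q) \<in> {p\<in>roabp_paths A. p ! k = w}"
      using join[OF pq(2,3)] pq(1) by simp
    have len: "length p = Suc k" "p ! k = q ! 0" "q \<noteq> []"
      using pq by (auto simp: path_prefixes_def path_suffixes_def Let_def)
    have "drop k p = [p ! k]"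
      using len by (simp add: Cons_nth_drop_Suc[symmetric])
    then have "drop k (p @ tl q) = q"
      using len by (cases q) auto
    then show "(take (Suc k) (case b of (p, q) \<Rightarrow> p @ tl q),
        drop k (case b of (p, q) \<Rightarrow> p @ tl q)) = b"
      using len pq(1) by simp
  qed
  then show ?thesis
    by (simp add: sum_product sum.cartesian_product)
qed

lemma roabp_width_lower_bound:
  fixes A :: "('w, ips_var, 'a::field) roabp" and \<beta> :: 'a
  assumes char: "CHAR('a) = 0 \<or> CHAR('a) > n"
    and \<beta>: "\<beta> \<notin> of_nat ` {0..n}"
    and C: "IPS_LIN_refutation n \<beta> (roabp_poly A)"
    and A: "wf_roabp (ips_vars n) A"
    and order: "reads_before (X ` {1..n}) (Y ` {1..n}) (var_order A)"
    and width: "roabp_width_le A r"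
  shows "2 ^ n \<le> r"
proof -
  let ?vs = "var_order A"
  define N where "N = length ?vs"
  \<comment> \<open>The cut k is placed right after the last x variable. The placeholders may be
    read on either side of it.\<close>
  have "\<exists>k\<le>N. (\<forall>i<k. ?vs ! i \<notin> Y ` {1..n}) \<and> (\<forall>i<N. k \<le> i \<longrightarrow> ?vs ! i \<notin> X ` {1..n})"
  proof (cases "\<exists>j<N. ?vs ! j \<in> X ` {1..n}")
    case True
    then have ne: "{j. j < N \<and> ?vs ! j \<in> X ` {1..n}} \<noteq> {}" by blast
    define m where "m = Max {j. j < N \<and> ?vs ! j \<in> X ` {1..n}}"
    have m: "m < N" "?vs ! m \<in> X ` {1..n}" "\<And>j. j < N \<Longrightarrow> ?vs ! j \<in> X ` {1..n} \<Longrightarrow> j \<le> m"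
      using Max_in[OF _ ne] by (auto simp: m_def)
    have "?vs ! i \<notin> Y ` {1..n}" if "i < Suc m" for i
      using order m(1,2) that unfolding reads_before_def N_def[symmetric]
      by (metis less_Suc_eq_le le_less_trans not_le)
    moreover have "?vs ! i \<notin> X ` {1..n}" if "i < N" "Suc m \<le> i" for i
      using m(3)[of i] that by auto
    ultimately show ?thesis using m(1) by (intro exI[of _ "Suc m"]) auto
  next
    case False
    then show ?thesis by (intro exI[of _ 0]) auto
  qed
  then obtain k where k: "k \<le> N"
    and noY: "\<And>i. i < k \<Longrightarrow> ?vs ! i \<notin> Y ` {1..n}"
    and noX: "\<And>i. i < N \<Longrightarrow> k \<le> i \<Longrightarrow> ?vs ! i \<notin> X ` {1..n}" by blast
  have vars: "?vs ! i \<in> ips_vars n" if "i < N" for i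
    using A that by (auto simp: wf_roabp_def Let_def N_def)
  define W where "W T S i a b = poly (label A a b) (cube_point T S (?vs ! i))" for T S i a b
  have layers: "finite (layer A k)" "card (layer A k) \<le> r"
    using A width k by (auto simp: wf_roabp_def roabp_width_le_def Let_def N_def)
  define L where "L w T = (\<Sum>p\<in>path_prefixes A k w. \<Prod>i<k. W T {} i (p ! i) (p ! Suc i))" for w T
  define R where "R w S =
    (\<Sum>q\<in>path_suffixes A k w. \<Prod>i<N - k. W {} S (k + i) (q ! i) (q ! Suc i))" for w S
  \<comment> \<open>Before the cut no y variable is read, and the placeholders have the same value
    at every cube point, so \<open>S\<close> may be replaced by the empty set.\<close>
  have W_left: "W T S i a b = W T {} i a b" if "i < k" for T S i a b
    using noY[OF that] vars[of i] k that
    by (cases "?vs ! i") (auto simp: W_def ips_vars_def placeholders_def)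
  have W_right: "W T S i a b = W {} S i a b" if "i < N" "k \<le> i" for T S i a b
    using noX[OF that] vars[of i] that
    by (cases "?vs ! i") (auto simp: W_def ips_vars_def placeholders_def)
  have eval: "mpoly_eval (cube_point T S) (roabp_poly A) = (\<Sum>w\<in>layer A k. L w T * R w S)" for T S
  proof -
    have "mpoly_eval (cube_point T S) (roabp_poly A) =
        (\<Sum>p\<in>roabp_paths A. \<Prod>i<N. W T S i (p ! i) (p ! Suc i))"
      by (simp add: roabp_poly_def mpoly_eval_univariate_in W_def N_def)
    \<comment> \<open>Every path meets layer k in exactly one vertex; grouping by it makes that
      layer the index set of the factorization.\<close>
    also have "\<dots> = (\<Sum>w\<in>layer A k. \<Sum>p\<in>{p\<in>roabp_paths A. p ! k = w}.
        \<Prod>i<N. W T S i (p ! i) (p ! Suc i))"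
      using finite_roabp_paths[OF A] layers(1) k
      by (intro sum.group[symmetric]) (auto simp: roabp_paths_def Let_def N_def)
    also have "\<dots> = (\<Sum>w\<in>layer A k. L w T * R w S)"
      unfolding sum_paths_through[OF k[unfolded N_def], folded N_def] L_def R_def
      by (simp add: W_left[of _ T S] W_right[of _ T S])
    finally show ?thesis .
  qed
  have "2 ^ n \<le> card (layer A k)"
    using refutation_eval_cube_point[OF C]
    by (intro rank_inverse_Int[OF char \<beta> layers(1), of L R]) (simp flip: eval)
  with layers(2) show ?thesis by simp
qed

text \<open>The rank argument applies directly: a power of degree d expands binomially into d + 1
  products of a function of \<open>T\<close> and a function of \<open>S\<close>. The pairs of
  summand and exponent in \<open>K\<close> index these products.\<close>

lemma powering_size_lower_bound:
  fixes F :: "(ips_var, 'a::field) powering_formula" and \<beta> :: 'a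
  assumes char: "CHAR('a) = 0 \<or> CHAR('a) > n"
    and \<beta>: "\<beta> \<notin> of_nat ` {0..n}"
    and C: "IPS_LIN_refutation n \<beta> (powering_poly (ips_vars n) F)"
  shows "2 ^ n \<le> powering_size (ips_vars n) F"
proof -
  let ?V = "ips_vars n"
  define B where "B j = fst (F ! j)" for j
  define a where "a j = fst (snd (F ! j))" for j
  define d where "d j = snd (snd (F ! j))" for j
  define K where "K = (SIGMA j:{..<length F}. {..d j})"
  have finV: "finite ?V" by (simp add: ips_vars_def placeholders_def)
  have card_K: "card K = (\<Sum>(b, a, d)\<leftarrow>F. d + 1)"
    by (simp add: K_def sum_list_sum_nth lessThan_atLeast0 d_def case_prod_beta)
  \<comment> \<open>The constant term and the placeholders, being constant on the cube, are assigned
    to the x side.\<close>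
  define l where "l j T = B j + (\<Sum>v\<in>?V - range Y. a j v * cube_point T {} v)" for j T
  define m where "m j S = (\<Sum>v\<in>?V \<inter> range Y. a j v * cube_point {} S v)" for j S
  define L where "L = (\<lambda>(j, i) T. of_nat (d j choose i) * l j T ^ i)"
  define R where "R = (\<lambda>(j, i) S. m j S ^ (d j - i))"
  have affine: "B j + (\<Sum>v\<in>?V. a j v * cube_point T S v) = l j T + m j S" for j T S
  proof -
    have "(\<Sum>v\<in>?V. a j v * cube_point T S v) =
        (\<Sum>v\<in>?V - range Y. a j v * cube_point T S v) + (\<Sum>v\<in>?V \<inter> range Y. a j v * cube_point T S v)"
      using finV by (subst sum.union_disjoint[symmetric]) (auto intro!: sum.cong)
    also have "(\<Sum>v\<in>?V - range Y. a j v * cube_point T S v) =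
        (\<Sum>v\<in>?V - range Y. a j v * cube_point T {} v)"
    proof (rule sum.cong)
      fix v assume "v \<in> ?V - range Y"
      then show "a j v * cube_point T S v = a j v * cube_point T {} v" by (cases v) auto
    qed simp
    also have "(\<Sum>v\<in>?V \<inter> range Y. a j v * cube_point T S v) =
        (\<Sum>v\<in>?V \<inter> range Y. a j v * cube_point {} S v)"
      by (rule sum.cong) auto
    finally show ?thesis by (simp add: l_def m_def)
  qed
  have eval: "mpoly_eval (cube_point T S) (powering_poly ?V F) = (\<Sum>k\<in>K. L k T * R k S)" for T S
  proof -
    have "mpoly_eval (cube_point T S) (powering_poly ?V F) =
        (\<Sum>j<length F. (B j + (\<Sum>v\<in>?V. a j v * cube_point T S v)) ^ d j)"
      by (simp add: powering_poly_def sum_list_sum_nth lessThan_atLeast0 case_prod_beta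
          B_def a_def d_def)
    also have "\<dots> = (\<Sum>j<length F. \<Sum>i\<le>d j. L (j, i) T * R (j, i) S)"
      unfolding affine binomial_ring by (simp add: L_def R_def)
    also have "\<dots> = (\<Sum>k\<in>K. L k T * R k S)"
      unfolding K_def by (subst sum.Sigma) (auto simp: case_prod_beta)
    finally show ?thesis .
  qed
  have "2 ^ n \<le> card K"
    using refutation_eval_cube_point[OF C]
    by (intro rank_inverse_Int[OF char \<beta>, of K L R]) (simp add: K_def, simp flip: eval)
  \<comment> \<open>The size is \<open>card K\<close> times the number of variables, a factor that
    is positive since \<open>U\<close> is among them.\<close>
  moreover have "card ?V \<ge> 1"
    using finV by (auto simp: Suc_le_eq card_gt_0_iff ips_vars_def placeholders_def)
  ultimately show ?thesis
    unfolding powering_size_def card_K[symmetric]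
    by (metis le_trans mult_le_mono1 nat_mult_1)
qed

theorem corollary5p10:
  fixes n :: nat and \<beta> :: "'a::field"
  assumes "n \<ge> 1"
    and "CHAR('a) = 0 \<or> CHAR('a) > n"
    and "\<beta> \<notin> of_nat ` {0..n}"
  shows "unsatisfiable (ip_system n \<beta>) \<and>
    Omega_const > 0 \<and>
    (\<forall>(C :: (ips_var, 'a) mpoly) (A :: ('w, ips_var, 'a) roabp) r.
       IPS_LIN_refutation n \<beta> C \<and> wf_roabp (ips_vars n) A \<and> roabp_poly A = C \<and>
       reads_before (X ` {1..n}) (Y ` {1..n}) (var_order A) \<and> roabp_width_le A r
       \<longrightarrow> real r \<ge> exp (Omega_const * real n)) \<and>
    (\<forall>(C :: (ips_var, 'a) mpoly) (F :: (ips_var, 'a) powering_formula).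
       IPS_LIN_refutation n \<beta> C \<and> powering_poly (ips_vars n) F = C
       \<longrightarrow> real (powering_size (ips_vars n) F) \<ge> exp (Omega_const * real n))"
proof -
  have exp_le: "exp (Omega_const * real n) \<le> real s" if "2 ^ n \<le> s" for s
  proof -
    have "exp (Omega_const * real n) \<le> real (2 ^ n)"
      using exp_Omega_const_le by simp
    also have "\<dots> \<le> real s" using that by (rule of_nat_mono)
    finally show ?thesis .
  qed
  show ?thesis
    using unsatisfiable_ip_system[OF assms(3)] roabp_width_lower_bound[OF assms(2,3)]
      powering_size_lower_bound[OF assms(2,3)]
    by (auto intro!: exp_le) (simp add: Omega_const_def)
qed

end
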